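(* There exist constants $\gamma,c>0$ such that $n(\delta)\ge c\,\delta^{-1-\gamma}$ for all $\delta\in(0,1)$.
   Context: Let $\Omega=[-1,1]^2\times[-1,1]$; an element $(x,y,\theta)\in\Omega$ is viewed as the point $p=(x,y)$ together with the line $p+(1,\theta)\mathbb{R}$ through it of slope $\theta$. For $\omega=(x,y,\theta)$ and $\omega'=(x',y',\theta')$ in $\Omega$ define the vertical distance $d(\omega,\omega')=|y-y'-\theta'(x-x')|$. For a finite set $X\subset\Omega$ define $d(X)=\min_{\omega\neq\omega'\in X} d(\omega,\omega')$ (the minimum over ordered pairs of distinct elements). For $\delta>0$, $n(\delta)$ is the largest integer $n$ such that there exists $X\subset\Omega$ with $|X|=n$ and $d(X)\ge\delta$. *)

theory Defs
  imports Complex_Main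
begin

text \<open>A triple \<open>(x, y, \<theta>)\<close> stands for the point \<open>p = (x, y)\<close> together with the line
  \<open>p + (1, \<theta>) \<real>\<close> of slope \<open>\<theta>\<close> through it.\<close>

definition Omega :: "(real \<times> real \<times> real) set" where
  "Omega = {-1..1} \<times> {-1..1} \<times> {-1..1}"

text \<open>Not symmetric: this is the vertical distance from the point of the first argument to the
  line of the second.\<close>

fun vdist :: "real \<times> real \<times> real \<Rightarrow> real \<times> real \<times> real \<Rightarrow> real" where
  "vdist (x, y, \<theta>) (x', y', \<theta>') = \<bar>y - y' - \<theta>' * (x - x')\<bar>"

text \<open>Meant for finite \<open>X\<close> with at least two elements; otherwise the value of \<open>Min\<close> is
  unspecified.\<close>

definition min_vdist :: "(real \<times> real \<times> real) set \<Rightarrow> real" where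
  "min_vdist X = Min {vdist \<omega> \<omega>' | \<omega> \<omega>'. \<omega> \<in> X \<and> \<omega>' \<in> X \<and> \<omega> \<noteq> \<omega>'}"

text \<open>For \<open>0 < \<delta> \<le> 2\<close> the maximum exists and is at least 2. Indeed
  \<open>{(0, -1, 0), (0, 1, 0)}\<close> is admissible, so the unspecified value of \<^const>\<open>min_vdist\<close> on sets
  with fewer than two elements has no influence. The cardinalities are bounded because
  \<open>vdist \<omega> \<omega>' \<le> \<bar>y - y'\<bar> + \<bar>x - x'\<bar>\<close> on \<^const>\<open>Omega\<close>.\<close>

definition max_card :: "real \<Rightarrow> nat" where
  "max_card \<delta> =
     (GREATEST n. \<exists>X. finite X \<and> X \<subseteq> Omega \<and> card X = n \<and> min_vdist X \<ge> \<delta>)"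

end

theory Submission
  imports Defs
begin

text \<open>The tangent lines of the parabolas \<open>y = x\<^sup>2 + t\<close> satisfy
  \<open>y - y' - \<theta>'(x - x') = (x - x')\<^sup>2 + t - t'\<close>. So let \<open>x\<close> range over all integers in
  \<open>[0, M)\<close> and \<open>t\<close> over a set \<open>T\<close> of integers in \<open>[0, M\<^sup>2)\<close> no two of which differ by a
  nonzero square: the expression above is then a nonzero integer for distinct elements, and
  rescaling to \<open>\<Omega>\<close> gives \<open>M |T|\<close> elements with separation \<open>M\<^sup>-\<^sup>2\<close>. This beats
  \<open>\<delta>\<^sup>-\<^sup>1\<close> as soon as \<open>|T|\<close> is a power larger than \<open>M\<close>. Ruzsa's construction provides such
  sets: for \<open>M = 5\<^sup>k\<close>, take the numbers whose base-5 digits in even positions are 0 or 2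
  (whose difference is not a square modulo 5) and whose other digits are arbitrary;
  then \<open>|T| = 10\<^sup>k\<close>.\<close>

section \<open>Sets of integers without square differences\<close>

lemma square_mod_5: "(n::int)\<^sup>2 mod 5 \<in> {0, 1, 4}"
proof -
  have "n mod 5 \<in> {0, 1, 2, 3, 4}"
    using pos_mod_bound[of 5 n] pos_mod_sign[of 5 n] by force
  moreover have "n\<^sup>2 mod 5 = (n mod 5)\<^sup>2 mod 5"
    by (simp add: power_mod)
  ultimately show ?thesis by auto
qed

text \<open>New digits enter at the low end, so that reduction modulo 5 and division by 25 lead back
  to the previous set.\<close>

fun ruzsa :: "nat \<Rightarrow> int set" where
  "ruzsa 0 = {0}"
| "ruzsa (Suc k) = (\<lambda>(s, a, r). 25 * s + 5 * a + r) ` (ruzsa k \<times> {0..4} \<times> {0, 2})"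

lemma ruzsa_SucE:
  assumes "t \<in> ruzsa (Suc k)"
  obtains s a r where "t = 25 * s + 5 * a + r" "s \<in> ruzsa k" "a \<in> {0..4}" "r \<in> {0, 2}"
  using assms by (clarsimp simp del: insert_iff)

lemma ruzsa_subset: "ruzsa k \<subseteq> {0..<25 ^ k}"
proof (induction k)
  case (Suc k)
  show ?case
  proof
    fix t assume "t \<in> ruzsa (Suc k)"
    then obtain s a r where t: "t = 25 * s + 5 * a + r" "s \<in> ruzsa k" "a \<in> {0..4}" "r \<in> {0, 2}"
      by (rule ruzsa_SucE)
    then have "s \<in> {0..<25 ^ k}"
      using Suc by blast
    then show "t \<in> {0..<25 ^ Suc k}"
      using t(1,3,4) by auto
  qed
qed simp

lemma base_5_digits_unique:
  fixes s a r s' a' r' :: int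
  assumes "a \<in> {0..4}" "a' \<in> {0..4}" "r \<in> {0, 2}" "r' \<in> {0, 2}"
    and "25 * s + 5 * a + r = 25 * s' + 5 * a' + r'"
  shows "s = s' \<and> a = a' \<and> r = r'"
proof -
  have *: "0 \<le> a" "a \<le> 4" "0 \<le> a'" "a' \<le> 4" "0 \<le> r" "r \<le> 2" "0 \<le> r'" "r' \<le> 2"
    using assms(1-4) by auto
  \<comment> \<open>\<open>5 * a + r\<close> is at most 22, hence a remainder modulo 25.\<close>
  then have "s = s'"
    using assms(5) by linarith
  moreover from this * have "a = a'"
    using assms(5) by linarith
  ultimately show ?thesis
    using assms(5) by linarith
qed

lemma card_ruzsa: "card (ruzsa k) = 10 ^ k"
proof (induction k)
  case (Suc k)
  have "inj_on (\<lambda>(s, a, r). 25 * s + 5 * a + r) (ruzsa k \<times> {0..4::int} \<times> {0, 2})"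
  proof (rule inj_onI, clarsimp simp del: insert_iff)
    fix s a r s' a' r' :: int
    assume "0 \<le> a" "a \<le> 4" "r \<in> {0, 2}" "0 \<le> a'" "a' \<le> 4" "r' \<in> {0, 2}"
      and "25 * s + 5 * a + r = 25 * s' + 5 * a' + r'"
    then show "s = s' \<and> a = a' \<and> r = r'"
      by (intro base_5_digits_unique) auto
  qed
  then show ?case
    using Suc by (simp add: card_image card_cartesian_product)
qed simp

text \<open>Descent: the residues 2 and 3 are not squares modulo 5, so the lowest digits agree and 5
  divides \<open>n\<close>. Then 25 divides \<open>n\<^sup>2\<close>, which forces
  \<open>a = a'\<close>, and division by 25 leaves a square difference in
  \<open>ruzsa k\<close>.\<close>

lemma ruzsa_square_difference_free:
  assumes "t \<in> ruzsa k" "t' \<in> ruzsa k" "t - t' = n\<^sup>2"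
  shows "t = t'"
  using assms
proof (induction k arbitrary: t t' n)
  case (Suc k)
  obtain s a r where t: "t = 25 * s + 5 * a + r" "s \<in> ruzsa k" "a \<in> {0..4}" "r \<in> {0, 2}"
    using Suc.prems(1) by (rule ruzsa_SucE)
  obtain s' a' r' where t': "t' = 25 * s' + 5 * a' + r'" "s' \<in> ruzsa k" "a' \<in> {0..4}" "r' \<in> {0, 2}"
    using Suc.prems(2) by (rule ruzsa_SucE)
  have n2: "n\<^sup>2 = 5 * (5 * (s - s') + (a - a')) + (r - r')"
    using Suc.prems(3) t(1) t'(1) by simp
  then have "n\<^sup>2 mod 5 = (r - r') mod 5"
    by (simp only: mod_mult_self4)
  then have r: "r = r'"
    using square_mod_5[of n] t(4) t'(4) by auto
  then have "5 dvd n\<^sup>2"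
    using n2 by simp
  then have "n mod 5 = 0"
  proof -
    have "(n mod 5)\<^sup>2 mod 5 = 0"
      using \<open>5 dvd n\<^sup>2\<close> by (simp add: power_mod)
    moreover have "n mod 5 \<in> {0, 1, 2, 3, 4}"
      using pos_mod_bound[of 5 n] pos_mod_sign[of 5 n] by force
    ultimately show ?thesis by auto
  qed
  then obtain m where m: "n = 5 * m"
    by auto
  then have eq: "5 * m\<^sup>2 = 5 * (s - s') + (a - a')"
    using n2 r by (simp add: power2_eq_square)
  then have "a - a' = 5 * (m\<^sup>2 - (s - s'))"
    by simp
  then have "5 dvd a - a'" ..
  then have a: "a = a'"
    using t(3) t'(3) by simp presburger
  then have "s - s' = m\<^sup>2"
    using eq by simp
  then have "s = s'"
    using Suc.IH t(2) t'(2) by blast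
  then show ?case
    using a r t(1) t'(1) by simp
qed simp

section \<open>Separated sets and the maximum \<open>max_card\<close>\<close>

lemma finite_ordered_pairs:
  assumes "finite X"
  shows "finite {vdist \<omega> \<omega>' | \<omega> \<omega>'. \<omega> \<in> X \<and> \<omega>' \<in> X \<and> \<omega> \<noteq> \<omega>'}"
proof (rule finite_subset)
  show "{vdist \<omega> \<omega>' | \<omega> \<omega>'. \<omega> \<in> X \<and> \<omega>' \<in> X \<and> \<omega> \<noteq> \<omega>'} \<subseteq> (\<lambda>(\<omega>, \<omega>'). vdist \<omega> \<omega>') ` (X \<times> X)"
    by blast
qed (use assms in simp)

lemma min_vdist_ge_iff:
  assumes "finite X" "card X \<ge> 2"
  shows "min_vdist X \<ge> \<delta> \<longleftrightarrow> (\<forall>\<omega>\<in>X. \<forall>\<omega>'\<in>X. \<omega> \<noteq> \<omega>' \<longrightarrow> vdist \<omega> \<omega>' \<ge> \<delta>)"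
proof -
  have "\<exists>\<omega>\<in>X. \<exists>\<omega>'\<in>X. \<omega> \<noteq> \<omega>'"
    using assms card_le_Suc0_iff_eq[of X] by force
  then have "{vdist \<omega> \<omega>' | \<omega> \<omega>'. \<omega> \<in> X \<and> \<omega>' \<in> X \<and> \<omega> \<noteq> \<omega>'} \<noteq> {}"
    by blast
  then show ?thesis
    unfolding min_vdist_def by (subst Min_ge_iff[OF finite_ordered_pairs[OF assms(1)]]) blast+
qed

text \<open>Two elements of \<open>\<Omega>\<close> whose \<open>(x, y)\<close> lie in the same cell of a grid of mesh \<open>\<delta>/2\<close> have
  vertical distance less than \<open>\<delta>\<close>.\<close>

lemma card_separated_le:
  assumes "\<delta> > 0" "X \<subseteq> Omega"
    and sep: "\<And>\<omega> \<omega>'. \<omega> \<in> X \<Longrightarrow> \<omega>' \<in> X \<Longrightarrow> \<omega> \<noteq> \<omega>' \<Longrightarrow> vdist \<omega> \<omega>' \<ge> \<delta>"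
  shows "card X \<le> card ({\<lfloor>-2/\<delta>\<rfloor>..\<lfloor>2/\<delta>\<rfloor>} \<times> {\<lfloor>-2/\<delta>\<rfloor>..\<lfloor>2/\<delta>\<rfloor>})"
proof (rule card_inj_on_le)
  let ?f = "\<lambda>(x::real, y::real, \<theta>::real). (\<lfloor>2*x/\<delta>\<rfloor>, \<lfloor>2*y/\<delta>\<rfloor>)"
  have close: "\<bar>u - v\<bar> < \<delta>/2" if "\<lfloor>2*u/\<delta>\<rfloor> = \<lfloor>2*v/\<delta>\<rfloor>" for u v :: real
  proof -
    have "2*u/\<delta> - 2*v/\<delta> < 1" "2*v/\<delta> - 2*u/\<delta> < 1"
      using that by linarith+
    then have "2*u - 2*v < \<delta>" "2*v - 2*u < \<delta>"
      using \<open>\<delta> > 0\<close> by (simp_all flip: diff_divide_distrib)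
    then show ?thesis
      by linarith
  qed
  show "inj_on ?f X"
  proof (rule inj_onI, rule ccontr)
    fix \<omega> \<omega>' assume \<omega>: "\<omega> \<in> X" "\<omega>' \<in> X" "?f \<omega> = ?f \<omega>'" "\<omega> \<noteq> \<omega>'"
    obtain x y \<theta> x' y' \<theta>' where [simp]: "\<omega> = (x, y, \<theta>)" "\<omega>' = (x', y', \<theta>')"
      by (metis prod_cases3)
    have "\<omega>' \<in> Omega"
      using \<omega>(2) \<open>X \<subseteq> Omega\<close> by blast
    then have "\<bar>\<theta>'\<bar> \<le> 1"
      by (auto simp: Omega_def)
    then have "\<bar>\<theta>' * (x - x')\<bar> \<le> \<bar>x - x'\<bar>"
      by (simp add: abs_mult mult_left_le_one_le)
    moreover have "\<bar>x - x'\<bar> < \<delta>/2" "\<bar>y - y'\<bar> < \<delta>/2"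
      using close \<omega>(3) by auto
    ultimately have "\<bar>y - y' - \<theta>' * (x - x')\<bar> < \<delta>"
      by linarith
    then show False
      using sep[OF \<omega>(1,2,4)] by simp
  qed
  have cell: "\<lfloor>-2/\<delta>\<rfloor> \<le> \<lfloor>2*u/\<delta>\<rfloor> \<and> \<lfloor>2*u/\<delta>\<rfloor> \<le> \<lfloor>2/\<delta>\<rfloor>" if "-1 \<le> u" "u \<le> 1" for u :: real
    using that \<open>\<delta> > 0\<close> by (intro conjI floor_mono divide_right_mono) auto
  show "?f ` X \<subseteq> {\<lfloor>-2/\<delta>\<rfloor>..\<lfloor>2/\<delta>\<rfloor>} \<times> {\<lfloor>-2/\<delta>\<rfloor>..\<lfloor>2/\<delta>\<rfloor>}"
    using \<open>X \<subseteq> Omega\<close> cell by (fastforce simp: Omega_def)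
qed simp

text \<open>\<open>GREATEST\<close> dominates every admissible cardinality only once these are
  bounded; the grid count provides the bound.\<close>

lemma card_le_max_card:
  assumes "\<delta> > 0" "X \<subseteq> Omega" "card X \<ge> 2"
    and sep: "\<And>\<omega> \<omega>'. \<omega> \<in> X \<Longrightarrow> \<omega>' \<in> X \<Longrightarrow> \<omega> \<noteq> \<omega>' \<Longrightarrow> vdist \<omega> \<omega>' \<ge> \<delta>"
  shows "card X \<le> max_card \<delta>"
  unfolding max_card_def
proof (rule Greatest_le_nat)
  have "finite X"
    using assms(3) by (metis card.infinite not_numeral_le_zero)
  then show "\<exists>Y. finite Y \<and> Y \<subseteq> Omega \<and> card Y = card X \<and> min_vdist Y \<ge> \<delta>"
    using assms(2) sep min_vdist_ge_iff[OF _ assms(3), of \<delta>] by (intro exI[of _ X]) simp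
next
  fix n assume "\<exists>Y. finite Y \<and> Y \<subseteq> Omega \<and> card Y = n \<and> min_vdist Y \<ge> \<delta>"
  then obtain Y where Y: "finite Y" "Y \<subseteq> Omega" "card Y = n" "min_vdist Y \<ge> \<delta>"
    by blast
  let ?b = "card ({\<lfloor>-2/\<delta>\<rfloor>..\<lfloor>2/\<delta>\<rfloor>} \<times> {\<lfloor>-2/\<delta>\<rfloor>..\<lfloor>2/\<delta>\<rfloor>})"
  \<comment> \<open>The 2 covers sets with fewer than two elements, where \<open>min_vdist\<close>
    is unspecified and gives no separation.\<close>
  show "n \<le> max 2 ?b"
  proof (cases "n \<ge> 2")
    case True
    then have "card Y \<le> ?b"
      using Y min_vdist_ge_iff[of Y \<delta>] by (intro card_separated_le[OF \<open>\<delta> > 0\<close>]) simp_all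
    then show ?thesis
      using Y(3) by simp
  qed simp
qed

section \<open>Tangent lines rescaled to \<open>Omega\<close>\<close>

text \<open>The shear by \<open>-x/M\<close> brings the slopes \<open>2x/M\<close> into \<open>[-1, 1]\<close> without affecting
  \<^const>\<open>vdist\<close>.\<close>

definition tangent :: "real \<Rightarrow> int \<times> int \<Rightarrow> real \<times> real \<times> real" where
  "tangent M = (\<lambda>(x, t). (x / M, (x\<^sup>2 + t) / M\<^sup>2 - x / M, 2 * x / M - 1))"

lemma vdist_tangent:
  assumes "M > 0"
  shows "vdist (tangent M (x, t)) (tangent M (x', t')) = \<bar>real_of_int ((x - x')\<^sup>2 + t - t')\<bar> / M\<^sup>2"
proof -
  have "(x\<^sup>2 + t) / M\<^sup>2 - x / M - ((x'\<^sup>2 + t') / M\<^sup>2 - x' / M) - (2 * x' / M - 1) * (x / M - x' / M)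
      = ((x - x')\<^sup>2 + t - t') / M\<^sup>2"
    using assms by (simp add: field_simps power2_eq_square)
  then show ?thesis
    using assms by (simp add: tangent_def abs_divide)
qed

lemma tangent_in_Omega:
  assumes "M > 0" "0 \<le> x" "x < M" "0 \<le> t" "t + 1 \<le> M\<^sup>2"
  shows "tangent M (x, t) \<in> Omega"
proof -
  define u v where "u = x / M" and "v = t / M\<^sup>2"
  have u: "0 \<le> u" "u \<le> 1" and v: "0 \<le> v" "v \<le> 1"
    using assms by (auto simp: u_def v_def)
  \<comment> \<open>The sheared height is \<open>u\<^sup>2 - u + v\<close>, where
    \<open>u\<^sup>2 - u\<close> lies in \<open>[-1/4, 0]\<close>.\<close>
  have "(u - 1/2)\<^sup>2 \<ge> 0" by simp
  then have "u\<^sup>2 - u \<ge> -1/4"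
    by (simp add: power2_eq_square algebra_simps)
  moreover have "u\<^sup>2 \<le> u"
    using u by (simp add: power2_eq_square mult_left_le)
  moreover have "tangent M (x, t) = (u, u\<^sup>2 + v - u, 2 * u - 1)"
    by (simp add: tangent_def u_def v_def power_divide add_divide_distrib)
  ultimately show ?thesis
    using u v by (auto simp: Omega_def)
qed

lemma max_card_ge_2:
  assumes "0 < \<delta>" "\<delta> \<le> 2"
  shows "max_card \<delta> \<ge> 2"
proof -
  have "card {(0, -1, 0), (0, 1, 0) :: real \<times> real \<times> real} \<le> max_card \<delta>"
    by (rule card_le_max_card) (use assms in \<open>auto simp: Omega_def\<close>)
  then show ?thesis by simp
qed

lemma max_card_ge_power:
  assumes "0 < \<delta>" "\<delta> \<le> 1 / 25 ^ k"
  shows "max_card \<delta> \<ge> 50 ^ k"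
\<comment> \<open>For \<open>k = 0\<close> the construction has a single element, so an explicit
  pair is used instead.\<close>
proof (cases "k = 0")
  case True
  then show ?thesis
    using max_card_ge_2[of \<delta>] assms by simp
next
  case False
  define S where "S = {0..<5 ^ k :: int} \<times> ruzsa k"
  let ?g = "tangent (5 ^ k)"
  have M2: "((5::real) ^ k)\<^sup>2 = 25 ^ k"
    by (simp add: power2_eq_square flip: power_mult_distrib)
  have sep: "vdist (?g p) (?g q) \<ge> \<delta>" if "p \<in> S" "q \<in> S" "p \<noteq> q" for p q
  proof -
    obtain x t x' t' where [simp]: "p = (x, t)" "q = (x', t')"
      by (metis surj_pair)
    \<comment> \<open>Equality would give \<open>t = t'\<close>, hence
      \<open>x = x'\<close>.\<close>
    have "t' - t \<noteq> (x - x')\<^sup>2"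
      using that ruzsa_square_difference_free[of t' k t "x - x'"] by (auto simp: S_def)
    then have "\<bar>(x - x')\<^sup>2 + t - t'\<bar> \<ge> 1"
      by linarith
    then have "\<bar>real_of_int ((x - x')\<^sup>2 + t - t')\<bar> \<ge> 1"
      by linarith
    then have "vdist (?g p) (?g q) \<ge> 1 / 25 ^ k"
      by (simp add: vdist_tangent M2 divide_right_mono del: of_int_add of_int_diff of_int_power)
    then show ?thesis
      using assms by simp
  qed
  \<comment> \<open>\<open>sep\<close> concerns distinct indices, so coinciding images would have
    distance 0 and at least \<open>\<delta>\<close>.\<close>
  have "inj_on ?g S"
  proof (rule inj_onI, rule ccontr)
    fix p q assume "p \<in> S" "q \<in> S" "?g p = ?g q" "p \<noteq> q"
    then have "vdist (?g q) (?g q) \<ge> \<delta>"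
      using sep by metis
    moreover have "vdist (?g q) (?g q) = 0"
      by (cases "?g q") simp
    ultimately show False
      using \<open>0 < \<delta>\<close> by simp
  qed
  then have card: "card (?g ` S) = 50 ^ k"
    by (simp add: card_image S_def card_cartesian_product card_ruzsa nat_power_eq
        flip: power_mult_distrib)
  have "?g ` S \<subseteq> Omega"
  proof
    fix \<omega> assume "\<omega> \<in> ?g ` S"
    then obtain x t where \<omega>: "\<omega> = ?g (x, t)" "0 \<le> x" "x < 5 ^ k" "t \<in> ruzsa k"
      by (auto simp: S_def)
    have "real_of_int x < 5 ^ k"
      using \<omega>(3) by (metis of_int_less_iff of_int_numeral of_int_power)
    moreover have "0 \<le> t" "t + 1 \<le> 25 ^ k"
      using ruzsa_subset \<omega>(4) by fastforce+
    moreover from this have "real_of_int t + 1 \<le> 25 ^ k"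
      by (metis of_int_1 of_int_add of_int_le_iff of_int_numeral of_int_power)
    ultimately show "\<omega> \<in> Omega"
      unfolding \<omega>(1) using \<omega>(2) by (intro tangent_in_Omega) (auto simp: M2)
  qed
  moreover have "card (?g ` S) \<ge> 2"
    using False self_le_power[of "50::nat" k] by (simp add: card)
  ultimately have "card (?g ` S) \<le> max_card \<delta>"
    using sep by (intro card_le_max_card[OF \<open>0 < \<delta>\<close>]) blast+
  then show ?thesis
    by (simp add: card)
qed

section \<open>Exponent and passage to arbitrary \<open>\<delta>\<close>\<close>

theorem theorem2p1:
  "\<exists>\<gamma> c :: real. \<gamma> > 0 \<and> c > 0 \<and>
     (\<forall>\<delta> :: real. 0 < \<delta> \<and> \<delta> < 1 \<longrightarrow> real (max_card \<delta>) \<ge> c * \<delta> powr (-1 - \<gamma>))"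
proof (intro exI conjI allI impI)
  \<comment> \<open>The exponent satisfies \<open>25 powr (1 + log 25 2) = 50\<close>, matching 50^k
    elements at scale 25^(-k). The factor 1/50 pays for rounding \<open>\<delta>\<close> to such a
    scale.\<close>
  show "log 25 2 > (0::real)" "1 / 50 > (0::real)"
    by simp_all
  fix \<delta> :: real assume \<delta>: "0 < \<delta> \<and> \<delta> < 1"
  define k where "k = nat \<lfloor>log 25 (1 / \<delta>)\<rfloor>"
  have "log 25 (1 / \<delta>) \<ge> 0"
    using \<delta> by simp
  then have k: "real k \<le> log 25 (1 / \<delta>)" "log 25 (1 / \<delta>) \<le> real (Suc k)"
    unfolding k_def by linarith+
  have "25 ^ k \<le> 1 / \<delta>"
    using k(1) \<delta> by (simp add: le_log_iff powr_realpow)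
  then have le: "\<delta> \<le> 1 / 25 ^ k"
    using \<delta> by (simp add: field_simps)
  have "\<delta> powr (-1 - log 25 2) = (1 / \<delta>) powr (1 + log 25 2)"
    using \<delta> powr_minus_divide[of \<delta> "1 + log 25 2"] by (simp add: powr_divide)
  also have "\<dots> \<le> (25 ^ Suc k) powr (1 + log 25 2)"
  proof (rule powr_mono2)
    show "1 / \<delta> \<le> 25 ^ Suc k"
      using k(2) \<delta> by (simp add: log_le_iff powr_realpow del: power_Suc of_nat_Suc)
  qed (use \<delta> in \<open>auto simp: add_nonneg_nonneg\<close>)
  also have "\<dots> = (25 powr (1 + log 25 2)) ^ Suc k"
    by (simp add: powr_powr mult.commute del: power_Suc flip: powr_realpow)
  also have "\<dots> = 50 ^ Suc k"
    by (simp add: powr_add)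
  finally have "1 / 50 * \<delta> powr (-1 - log 25 2) \<le> 50 ^ k"
    by simp
  also have "\<dots> \<le> real (max_card \<delta>)"
    using max_card_ge_power[of \<delta> k] \<delta> le by (metis of_nat_le_iff of_nat_numeral of_nat_power)
  finally show "1 / 50 * \<delta> powr (-1 - log 25 2) \<le> real (max_card \<delta>)" .
qed

end
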